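(* Let $\alpha,\beta$ be parameters, $n\ge1$, $x_1,\dots,x_n$ variables and $\lambda$ a partition. Then $G^{(\alpha,\beta)}_\lambda(x_1,\dots,x_n)$ equals the partition function of the following lattice model: $n$ rows with bosonic horizontal labels (nonnegative integers), row $k$ (from the bottom) having parameter $x_k$, bottom boundary all $0$, top boundary $(m^c_j(\lambda))_{j\ge1}$, right boundary value $0$, free left boundary, and vertex weights $$w_x(a,b;c,d)=\delta_{a+b,c+d}\begin{cases}\big(\frac{x}{1-\alpha x}\big)^{a}& b=c,\\ \big(\frac{x}{1-\alpha x}\big)^{a}\frac{1+\beta x}{1-\alpha x}& b>c,\\ 0& b<c.\end{cases}$$
   Context: Canonical Grothendieck polynomials. For partitions $\mu\subseteq\lambda$, $\lambda/\mu$ is a horizontal strip if $\lambda_1\ge\mu_1\ge\lambda_2\ge\mu_2\ge\cdots$. Put $\bar\lambda=(\lambda_2,\lambda_3,\dots)$; for a skew shape $\kappa/\nu$, $r(\kappa/\nu)$ is the number of $i$ with $\kappa_i>\nu_i$. The $G^{(\alpha,\beta)}_\lambda$ are determined by $G^{(\alpha,\beta)}_\lambda()=\delta_{\lambda,\emptyset}$ (no variables) and $G^{(\alpha,\beta)}_\lambda(x_1,\dots,x_{n+1})=\sum_{\mu:\lambda/\mu\text{ horizontal strip}}G^{(\alpha,\beta)}_\mu(x_1,\dots,x_n)\big(\frac{x}{1-\alpha x}\big)^{|\lambda|-|\mu|}\big(\frac{1+\beta x}{1-\alpha x}\big)^{r(\mu/\bar\lambda)}$ with $x=x_{n+1}$.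 Lattice conventions. A vertex has left label $a$, bottom label $b$, right label $c$, top label $d$. A row with parameter $x$ is a sequence of vertices at sites $j=1,2,\dots$, the right label at site $j$ being the left label at site $j+1$; vertical labels are nonnegative integers; the left label at site 1 is free (summed over all values) and the right labels must be eventually equal to the prescribed right boundary value. Rows $1,\dots,n$ are stacked bottom to top, top labels of row $k$ = bottom labels of row $k+1$; bottom labels of row 1 and top labels of row $n$ are prescribed. The partition function is the sum over all labelings of non-prescribed edges of the product of vertex weights. $m^c_j(\lambda)=\lambda_j-\lambda_{j+1}$ is the number of columns of $\lambda$ of length $j$. *)

theory Defs
  imports Complex_Main "HOL-Library.FuncSet"
begin

text \<open>All indices start at \<open>0\<close>: a partition is the sequence of its parts, padded with zeros,
  with \<open>lam i\<close> standing for $\lambda_{i+1}$; likewise variables, rows and sites are numbered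
  from \<open>0\<close>.\<close>

definition is_partition :: "(nat \<Rightarrow> nat) \<Rightarrow> bool" where
  "is_partition lam \<longleftrightarrow> antimono lam \<and> finite {i. lam i \<noteq> 0}"

definition psize :: "(nat \<Rightarrow> nat) \<Rightarrow> nat" where
  "psize lam = (\<Sum>i | lam i \<noteq> 0. lam i)"

definition horizontal_strip :: "(nat \<Rightarrow> nat) \<Rightarrow> (nat \<Rightarrow> nat) \<Rightarrow> bool" where
  "horizontal_strip lam mu \<longleftrightarrow>
     is_partition lam \<and> is_partition mu \<and> (\<forall>i. lam i \<ge> mu i \<and> mu i \<ge> lam (Suc i))"

definition pbar :: "(nat \<Rightarrow> nat) \<Rightarrow> nat \<Rightarrow> nat" where
  "pbar lam = (\<lambda>i. lam (Suc i))"

definition skew_rows :: "(nat \<Rightarrow> nat) \<Rightarrow> (nat \<Rightarrow> nat) \<Rightarrow> nat" where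
  "skew_rows kappa nu = card {i. kappa i > nu i}"

definition col_mult :: "(nat \<Rightarrow> nat) \<Rightarrow> nat \<Rightarrow> nat" where
  "col_mult lam = (\<lambda>j. lam j - lam (Suc j))"

text \<open>\<open>grothendieck \<alpha> \<beta> x n lam\<close> is $G^{(\alpha,\beta)}_\lambda$ in the \<open>n\<close> variables
  \<open>x 0, \<dots>, x (n - 1)\<close>.\<close>

primrec grothendieck ::
  "'a::field \<Rightarrow> 'a \<Rightarrow> (nat \<Rightarrow> 'a) \<Rightarrow> nat \<Rightarrow> (nat \<Rightarrow> nat) \<Rightarrow> 'a" where
  "grothendieck \<alpha> \<beta> x 0 lam = (if lam = (\<lambda>_. 0) then 1 else 0)"
| "grothendieck \<alpha> \<beta> x (Suc n) lam =
     (\<Sum>mu | horizontal_strip lam mu.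
        grothendieck \<alpha> \<beta> x n mu
        * (x n / (1 - \<alpha> * x n)) ^ (psize lam - psize mu)
        * ((1 + \<beta> * x n) / (1 - \<alpha> * x n)) ^ skew_rows mu (pbar lam))"

text \<open>A labeling of \<open>n\<close> rows is a pair \<open>(h, v)\<close>: the vertex in row \<open>k < n\<close> at site \<open>j\<close> has
  left label \<open>h k j\<close>, bottom label \<open>v k j\<close>, right label \<open>h k (Suc j)\<close> and top label
  \<open>v (Suc k) j\<close>. Extensionality in \<open>k\<close> makes labelings correspond bijectively to assignments of
  labels to the edges that are actually present.\<close>

type_synonym labeling = "(nat \<Rightarrow> nat \<Rightarrow> nat) \<times> (nat \<Rightarrow> nat \<Rightarrow> nat)"

definition labelings ::
  "nat \<Rightarrow> (nat \<Rightarrow> nat) \<Rightarrow> (nat \<Rightarrow> nat) \<Rightarrow> nat \<Rightarrow> labeling set" where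
  "labelings n lo hi r =
     {(h, v). h \<in> {..<n} \<rightarrow>\<^sub>E UNIV \<and> v \<in> {..n} \<rightarrow>\<^sub>E UNIV \<and>
        v 0 = lo \<and> v n = hi \<and> (\<forall>k<n. \<forall>\<^sub>F j in sequentially. h k j = r)}"

definition partial_weight ::
  "(nat \<Rightarrow> nat \<Rightarrow> nat \<Rightarrow> nat \<Rightarrow> nat \<Rightarrow> 'a::field) \<Rightarrow> nat \<Rightarrow> labeling \<Rightarrow> nat \<Rightarrow> 'a" where
  "partial_weight w n L N =
     (case L of (h, v) \<Rightarrow> \<Prod>j<N. \<Prod>k<n. w k (h k j) (v k j) (h k (Suc j)) (v (Suc k) j))"

text \<open>The product over the infinitely many sites is the eventual value of the partial products;
  in particular it is \<open>0\<close> as soon as one vertex weight vanishes.\<close>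

definition has_weight ::
  "(nat \<Rightarrow> nat \<Rightarrow> nat \<Rightarrow> nat \<Rightarrow> nat \<Rightarrow> 'a::field) \<Rightarrow> nat \<Rightarrow> labeling \<Rightarrow> 'a \<Rightarrow> bool" where
  "has_weight w n L p \<longleftrightarrow> (\<forall>\<^sub>F N in sequentially. partial_weight w n L N = p)"

definition weight ::
  "(nat \<Rightarrow> nat \<Rightarrow> nat \<Rightarrow> nat \<Rightarrow> nat \<Rightarrow> 'a::field) \<Rightarrow> nat \<Rightarrow> labeling \<Rightarrow> 'a" where
  "weight w n L = (THE p. has_weight w n L p)"

definition nonzero_labelings ::
  "(nat \<Rightarrow> nat \<Rightarrow> nat \<Rightarrow> nat \<Rightarrow> nat \<Rightarrow> 'a::field) \<Rightarrow> nat \<Rightarrow> (nat \<Rightarrow> nat) \<Rightarrow> (nat \<Rightarrow> nat) \<Rightarrow> nat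
     \<Rightarrow> labeling set" where
  "nonzero_labelings w n lo hi r = {L \<in> labelings n lo hi r. weight w n L \<noteq> 0}"

text \<open>The set of labelings is infinite, so the partition function is the sum over the labelings of
  nonzero weight. It is meaningful when every labeling has a weight and only finitely many weights
  are nonzero; otherwise \<open>partition_function\<close> is a junk value.\<close>

definition partition_function_exists ::
  "(nat \<Rightarrow> nat \<Rightarrow> nat \<Rightarrow> nat \<Rightarrow> nat \<Rightarrow> 'a::field) \<Rightarrow> nat \<Rightarrow> (nat \<Rightarrow> nat) \<Rightarrow> (nat \<Rightarrow> nat) \<Rightarrow> nat
     \<Rightarrow> bool" where
  "partition_function_exists w n lo hi r \<longleftrightarrow>
     (\<forall>L \<in> labelings n lo hi r. \<exists>p. has_weight w n L p) \<and>
     finite (nonzero_labelings w n lo hi r)"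

definition partition_function ::
  "(nat \<Rightarrow> nat \<Rightarrow> nat \<Rightarrow> nat \<Rightarrow> nat \<Rightarrow> 'a::field) \<Rightarrow> nat \<Rightarrow> (nat \<Rightarrow> nat) \<Rightarrow> (nat \<Rightarrow> nat) \<Rightarrow> nat
     \<Rightarrow> 'a" where
  "partition_function w n lo hi r =
     (\<Sum>L \<in> nonzero_labelings w n lo hi r. weight w n L)"

definition vertex_weight ::
  "'a::field \<Rightarrow> 'a \<Rightarrow> 'a \<Rightarrow> nat \<Rightarrow> nat \<Rightarrow> nat \<Rightarrow> nat \<Rightarrow> 'a" where
  "vertex_weight \<alpha> \<beta> x a b c d =
     (if a + b = c + d then
        (if b = c then (x / (1 - \<alpha> * x)) ^ a
         else if b > c then (x / (1 - \<alpha> * x)) ^ a * ((1 + \<beta> * x) / (1 - \<alpha> * x))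
         else 0)
      else 0)"

end

theory Submission imports Defs begin

text \<open>If no vertex weight in the top row vanishes, then \<open>a + b = c + d\<close> and \<open>b \<ge> c\<close> bound the left
  label at site \<open>j\<close> by the top label there, so that subtracting the horizontal labels
  from \<open>lam\<close> gives a partition \<open>mu\<close> with \<open>lam / mu\<close> a horizontal strip, and the bottom labels of the
  row are the column multiplicities of \<open>mu\<close>. Conversely, every horizontal strip arises from
  exactly one row, whose weight is the branching factor of the Grothendieck polynomial. Removing
  the top row thus turns the partition function into the defining recursion.\<close>

section \<open>Partitions, column multiplicities and finiteness of strips\<close>

lemma partition_vanishes_beyond:
  assumes "is_partition lam"
  obtains M where "\<And>i. i \<ge> M \<Longrightarrow> lam i = 0"
proof -
  have "finite {i. lam i \<noteq> 0}"
    using assms by (simp add: is_partition_def)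
  then obtain M where "\<forall>i\<in>{i. lam i \<noteq> 0}. i < M"
    by (auto simp: finite_nat_set_iff_bounded)
  then show thesis
    by (intro that[of M]) (meson leD mem_Collect_eq)
qed

lemma psize_eq_sum_lessThan:
  assumes "\<And>i. i \<ge> N \<Longrightarrow> lam i = 0"
  shows "psize lam = (\<Sum>i<N. lam i)"
  unfolding psize_def
proof (rule sum.mono_neutral_left)
  show "{i. lam i \<noteq> 0} \<subseteq> {..<N}"
    using assms by (metis (mono_tags) lessThan_iff mem_Collect_eq not_le subsetI)
qed auto

text \<open>Subtraction is truncated, so vanishing multiplicities only say that \<open>lam\<close>
  never decreases; being eventually zero then forces it to be zero throughout. This identifies the
  empty partition when there are no rows.\<close>

lemma col_mult_eq_0_iff:
  assumes "is_partition lam"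
  shows "col_mult lam = (\<lambda>_. 0) \<longleftrightarrow> lam = (\<lambda>_. 0)"
proof
  assume eq: "col_mult lam = (\<lambda>_. 0)"
  have "lam i \<le> lam (Suc i)" for i
    using fun_cong[OF eq, of i] by (simp add: col_mult_def)
  then have up: "lam i \<le> lam j" if "i \<le> j" for i j
    using that by (rule lift_Suc_mono_le)
  obtain M where "\<And>i. i \<ge> M \<Longrightarrow> lam i = 0"
    using partition_vanishes_beyond[OF assms] by blast
  then have "lam i = 0" for i
    using up[of i "max i M"] by simp
  then show "lam = (\<lambda>_. 0)"
    by auto
qed (simp add: col_mult_def)

text \<open>Since \<open>mu i \<le> lam i\<close>, the parts of \<open>mu\<close> are bounded by
  \<open>lam 0\<close> and vanish wherever those of \<open>lam\<close> do. Without this the sum in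
  the recursion would default to \<open>0\<close>.\<close>

lemma finite_horizontal_strips: "finite {mu. horizontal_strip lam mu}"
proof (cases "is_partition lam")
  case True
  then obtain M where M: "\<And>i. i \<ge> M \<Longrightarrow> lam i = 0"
    using partition_vanishes_beyond by blast
  have anti: "antimono lam"
    using True by (simp add: is_partition_def)
  have bound: "mu i \<le> lam 0" "i \<ge> M \<Longrightarrow> mu i = 0" if "horizontal_strip lam mu" for mu i
  proof -
    have "mu i \<le> lam i"
      using that by (simp add: horizontal_strip_def)
    then show "mu i \<le> lam 0" "i \<ge> M \<Longrightarrow> mu i = 0"
      using antimonoD[OF anti, of 0 i] M[of i] by auto
  qed
  have "{mu. horizontal_strip lam mu} \<subseteq>
      {f. \<forall>i. (i \<in> {..<M} \<longrightarrow> f i \<in> {..lam 0}) \<and> (i \<notin> {..<M} \<longrightarrow> f i = 0)}"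
    using bound by auto
  then show ?thesis
    by (rule finite_subset) (intro finite_set_of_finite_funs; simp)
qed (simp add: horizontal_strip_def)

section \<open>Single rows and horizontal strips\<close>

text \<open>Here \<open>a + b\<close> and \<open>c + d\<close> both equal
  \<open>lam j - mu (Suc j)\<close>, and \<open>b - c\<close> equals
  \<open>mu j - lam (Suc j)\<close>. So interlacing gives \<open>b \<ge> c\<close>, and
  \<open>b > c\<close> holds exactly when row \<open>j\<close> of \<open>mu / pbar lam\<close> is
  nonempty.\<close>

lemma horizontal_strip_vertex_weight:
  assumes "horizontal_strip lam mu"
  shows "vertex_weight \<alpha> \<beta> x (lam j - mu j) (col_mult mu j) (lam (Suc j) - mu (Suc j))
      (col_mult lam j) =
    (x / (1 - \<alpha> * x)) ^ (lam j - mu j) *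
      ((1 + \<beta> * x) / (1 - \<alpha> * x)) ^ of_bool (mu j > pbar lam j)"
proof -
  have "mu j \<le> lam j" "lam (Suc j) \<le> mu j" "mu (Suc j) \<le> lam (Suc j)"
    using assms by (auto simp: horizontal_strip_def)
  then show ?thesis
    by (auto simp: vertex_weight_def col_mult_def pbar_def)
qed

text \<open>Beyond the last nonzero part of \<open>lam\<close> both exponents are \<open>0\<close>,
  so every further vertex has weight \<open>1\<close>; before it the exponents add up to the size of
  the strip and the number of nonempty rows.\<close>

lemma horizontal_strip_row_weight:
  assumes "horizontal_strip lam mu"
  shows "\<forall>\<^sub>F N in sequentially.
    (\<Prod>j<N. vertex_weight \<alpha> \<beta> x (lam j - mu j) (col_mult mu j) (lam (Suc j) - mu (Suc j))
      (col_mult lam j)) =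
    (x / (1 - \<alpha> * x)) ^ (psize lam - psize mu) *
      ((1 + \<beta> * x) / (1 - \<alpha> * x)) ^ skew_rows mu (pbar lam)"
proof -
  have le: "mu i \<le> lam i" for i
    using assms by (simp add: horizontal_strip_def)
  obtain M where M: "\<And>i. i \<ge> M \<Longrightarrow> lam i = 0"
    using assms partition_vanishes_beyond by (auto simp: horizontal_strip_def)
  show ?thesis
  proof (rule eventually_sequentiallyI)
    fix N assume "N \<ge> M"
    then have lam0: "lam i = 0" and mu0: "mu i = 0" if "i \<ge> N" for i
      using M[of i] le[of i] that by auto
    have size: "(\<Sum>j<N. lam j - mu j) = psize lam - psize mu"
      using sum_subtractf_nat[of "{..<N}" mu lam] le
      by (simp add: psize_eq_sum_lessThan[OF lam0] psize_eq_sum_lessThan[OF mu0])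
    have "j < N" if "mu j > pbar lam j" for j
      using mu0[of j] that by (cases "j < N") auto
    then have "{j. mu j > pbar lam j} = {..<N} \<inter> {j. mu j > pbar lam j}"
      by auto
    then have rows: "(\<Sum>j<N. of_bool (mu j > pbar lam j)) = skew_rows mu (pbar lam)"
      by (simp add: skew_rows_def sum_of_bool_eq)
    show "(\<Prod>j<N. vertex_weight \<alpha> \<beta> x (lam j - mu j) (col_mult mu j)
        (lam (Suc j) - mu (Suc j)) (col_mult lam j)) =
      (x / (1 - \<alpha> * x)) ^ (psize lam - psize mu) *
        ((1 + \<beta> * x) / (1 - \<alpha> * x)) ^ skew_rows mu (pbar lam)"
      unfolding horizontal_strip_vertex_weight[OF assms] prod.distrib size[symmetric]
        rows[symmetric] power_sum ..
  qed
qed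

text \<open>Conservation together with \<open>b j \<ge> a (Suc j)\<close> gives
  \<open>a j \<le> lam j - lam (Suc j)\<close>. This is the interlacing condition for
  \<open>lam - a\<close>, and conservation then determines \<open>b\<close>.\<close>

lemma row_is_horizontal_strip:
  fixes a b :: "nat \<Rightarrow> nat"
  assumes lam: "is_partition lam"
    and nz: "\<And>j. vertex_weight \<alpha> \<beta> x (a j) (b j) (a (Suc j)) (col_mult lam j) \<noteq> 0"
  obtains mu where "horizontal_strip lam mu" "a = (\<lambda>j. lam j - mu j)" "b = col_mult mu"
proof
  \<comment> \<open>For \<open>mu \<le> lam\<close> the required equation for \<open>a\<close>
    forces this witness.\<close>
  define mu where "mu = (\<lambda>j. lam j - a j)"
  have dec: "lam (Suc j) \<le> lam j" for j
    using lam by (auto simp: is_partition_def intro: antimonoD)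
  have bal: "a j + b j = a (Suc j) + (lam j - lam (Suc j))" and ge: "b j \<ge> a (Suc j)" for j
    using nz[of j] by (auto simp: vertex_weight_def col_mult_def split: if_splits)
  have a_le: "a j \<le> lam j - lam (Suc j)" for j
    using bal[of j] ge[of j] by linarith
  have mu: "mu j \<le> lam j" "lam (Suc j) \<le> mu j" for j
    using a_le[of j] dec[of j] by (auto simp: mu_def)
  have "antimono mu"
    by (intro antimono_iff_le_Suc[THEN iffD2] allI) (rule order_trans[OF mu(1) mu(2)])
  moreover have "finite {i. mu i \<noteq> 0}"
  proof (rule finite_subset)
    show "{i. mu i \<noteq> 0} \<subseteq> {i. lam i \<noteq> 0}"
      by (auto simp: mu_def)
  qed (use lam in \<open>simp add: is_partition_def\<close>)
  ultimately show "horizontal_strip lam mu"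
    using lam mu by (simp add: horizontal_strip_def is_partition_def)
  show "a = (\<lambda>j. lam j - mu j)"
  proof
    show "a j = lam j - mu j" for j
      using a_le[of j] dec[of j] by (simp add: mu_def)
  qed
  show "b = col_mult mu"
  proof
    show "b j = col_mult mu j" for j
      \<comment> \<open>The bounds at \<open>j\<close> and \<open>Suc j\<close> ensure that none of
        the natural-number differences is truncated.\<close>
      using bal[of j] a_le[of j] a_le[of "Suc j"] dec[of j] dec[of "Suc j"]
      by (simp add: mu_def col_mult_def)
  qed
qed

section \<open>Weights as eventual values of partial products\<close>

lemma has_weight_unique: "has_weight w n L p \<Longrightarrow> has_weight w n L q \<Longrightarrow> p = q"
  unfolding has_weight_def
  by (drule (1) eventually_conj) (auto simp: eventually_sequentially)

lemma weight_eqI: "has_weight w n L p \<Longrightarrow> weight w n L = p"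
  unfolding weight_def by (blast intro: has_weight_unique)

lemma has_weight_0_if_vertex_0:
  assumes "k < n" "w k (h k j) (v k j) (h k (Suc j)) (v (Suc k) j) = 0"
  shows "has_weight w n (h, v) 0"
  unfolding has_weight_def
proof (rule eventually_sequentiallyI)
  show "partial_weight w n (h, v) N = 0" if "N \<ge> Suc j" for N
    using that assms by (auto simp: partial_weight_def Suc_le_eq)
qed

text \<open>Serves to ignore the entries of a labeling that are overwritten when a row is put on
  top.\<close>

lemma partial_weight_cong:
  assumes "\<And>k. k < n \<Longrightarrow> h k = h' k" "\<And>k. k \<le> n \<Longrightarrow> v k = v' k"
  shows "partial_weight w n (h, v) N = partial_weight w n (h', v') N"
  using assms by (simp add: partial_weight_def)

lemma partial_weight_Suc:
  "partial_weight w (Suc n) (h, v) N =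
    partial_weight w n (h, v) N *
      (\<Prod>j<N. w n (h n j) (v n j) (h n (Suc j)) (v (Suc n) j))"
  by (simp add: partial_weight_def prod.distrib)

section \<open>Labelings built from chains of horizontal strips\<close>

text \<open>The bottom labels of the new row are already present as the top labels
  \<open>v n\<close>, which are \<open>col_mult mu\<close> for the labelings in question; only the
  horizontal labels and the new top boundary are written.\<close>

definition add_strip :: "nat \<Rightarrow> (nat \<Rightarrow> nat) \<Rightarrow> (nat \<Rightarrow> nat) \<times> labeling \<Rightarrow> labeling" where
  "add_strip n lam = (\<lambda>(mu, h, v). (h(n := \<lambda>j. lam j - mu j), v(Suc n := col_mult lam)))"

text \<open>Mirrors the recursion of \<open>grothendieck\<close>, with one labeling for each chain
  of horizontal strips from the empty partition up to \<open>lam\<close>.\<close>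

primrec strip_labelings :: "nat \<Rightarrow> (nat \<Rightarrow> nat) \<Rightarrow> labeling set" where
  "strip_labelings 0 lam = labelings 0 (\<lambda>_. 0) (col_mult lam) 0"
| "strip_labelings (Suc n) lam =
     add_strip n lam ` (SIGMA mu:{mu. horizontal_strip lam mu}. strip_labelings n mu)"

text \<open>With no rows \<open>v 0\<close> is both the bottom and the top boundary, so a labeling
  exists only for the empty partition. Extensionality fixes all other entries as
  \<open>undefined\<close>.\<close>

lemma labelings_0:
  assumes "is_partition lam"
  shows "labelings 0 (\<lambda>_. 0) (col_mult lam) 0 =
    (if lam = (\<lambda>_. 0) then {(\<lambda>_. undefined, (\<lambda>_. undefined)(0 := (\<lambda>_. 0)))} else {})"
  using col_mult_eq_0_iff[OF assms]
  by (auto simp: labelings_def PiE_def extensional_def fun_eq_iff)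

lemma strip_labelings_subset:
  assumes "is_partition lam"
  shows "strip_labelings n lam \<subseteq> labelings n (\<lambda>_. 0) (col_mult lam) 0"
  using assms
proof (induction n arbitrary: lam)
  case (Suc n)
  show ?case
  proof
    fix L assume "L \<in> strip_labelings (Suc n) lam"
    then obtain mu h v where mu: "horizontal_strip lam mu" and hv: "(h, v) \<in> strip_labelings n mu"
      and L: "L = (h(n := \<lambda>j. lam j - mu j), v(Suc n := col_mult lam))"
      by (auto simp: add_strip_def)
    have IH: "(h, v) \<in> labelings n (\<lambda>_. 0) (col_mult mu) 0"
      using Suc.IH mu hv by (auto simp: horizontal_strip_def)
    obtain M where M: "\<And>i. i \<ge> M \<Longrightarrow> lam i = 0"
      using partition_vanishes_beyond[OF Suc.prems] by blast
    \<comment> \<open>Under truncated subtraction this makes the new horizontal labels eventually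
      \<open>0\<close>, as the right boundary demands.\<close>
    have "\<forall>\<^sub>F j in sequentially. lam j \<le> mu j"
      by (rule eventually_sequentiallyI[of M]) (simp add: M)
    with IH show "L \<in> labelings (Suc n) (\<lambda>_. 0) (col_mult lam) 0"
      unfolding L by (auto simp: labelings_def PiE_def extensional_def less_Suc_eq)
  qed
qed simp

lemma finite_strip_labelings:
  assumes "is_partition lam"
  shows "finite (strip_labelings n lam)"
  using assms
proof (induction n arbitrary: lam)
  case 0
  then show ?case by (simp add: labelings_0)
next
  case (Suc n)
  have "finite (strip_labelings n mu)" if "horizontal_strip lam mu" for mu
    using that Suc.IH by (simp add: horizontal_strip_def)
  then show ?case
    by (auto intro!: finite_SigmaI finite_horizontal_strips)
qed

text \<open>The horizontal labels of the top row determine \<open>mu\<close> because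
  \<open>mu \<le> lam\<close>; nothing of \<open>h\<close> and \<open>v\<close> is lost because the
  overwritten entries were \<open>undefined\<close>.\<close>

lemma inj_on_add_strip:
  "inj_on (add_strip n lam) (SIGMA mu:{mu. horizontal_strip lam mu}. strip_labelings n mu)"
proof (rule inj_onI, clarsimp simp: add_strip_def)
  fix mu h v mu' h' v'
  assume mu: "horizontal_strip lam mu" "horizontal_strip lam mu'"
    and hv: "(h, v) \<in> strip_labelings n mu" "(h', v') \<in> strip_labelings n mu'"
    and eqh: "h(n := \<lambda>j. lam j - mu j) = h'(n := \<lambda>j. lam j - mu' j)"
    and eqv: "v(Suc n := col_mult lam) = v'(Suc n := col_mult lam)"
  have "mu j = mu' j" for j
  proof -
    have "mu j \<le> lam j" "mu' j \<le> lam j"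
      using mu by (simp_all add: horizontal_strip_def)
    moreover have "lam j - mu j = lam j - mu' j"
      using fun_cong[OF fun_cong[OF eqh, of n], of j] by simp
    ultimately show ?thesis by linarith
  qed
  then have "mu = mu'"
    by auto
  have ext: "g n = undefined \<and> u (Suc n) = undefined"
    if "horizontal_strip lam nu" "(g, u) \<in> strip_labelings n nu" for g u nu
  proof -
    have "(g, u) \<in> labelings n (\<lambda>_. 0) (col_mult nu) 0"
      using that strip_labelings_subset unfolding horizontal_strip_def by blast
    then show ?thesis
      by (simp add: labelings_def PiE_def extensional_def)
  qed
  have "h = h'" "v = v'"
    using eqh eqv ext[OF mu(1) hv(1)] ext[OF mu(2) hv(2)] by (metis fun_upd_triv fun_upd_upd)+
  with \<open>mu = mu'\<close> show "mu = mu' \<and> h = h' \<and> v = v'"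
    by simp
qed

text \<open>Induction on the number of rows: the top row is a horizontal strip
  \<open>lam / mu\<close>, and the rows below form a nonvanishing labeling with top boundary
  \<open>col_mult mu\<close>.\<close>

lemma nonvanishing_labeling_in_strip_labelings:
  assumes "is_partition lam"
    and "(h, v) \<in> labelings n (\<lambda>_. 0) (col_mult lam) 0"
    and "\<And>k j. k < n \<Longrightarrow>
      vertex_weight \<alpha> \<beta> (x k) (h k j) (v k j) (h k (Suc j)) (v (Suc k) j) \<noteq> 0"
  shows "(h, v) \<in> strip_labelings n lam"
  using assms
proof (induction n arbitrary: lam h v)
  case (Suc n)
  have top: "v (Suc n) = col_mult lam"
    using Suc.prems(2) by (simp add: labelings_def)
  obtain mu where mu: "horizontal_strip lam mu" and hn: "h n = (\<lambda>j. lam j - mu j)"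
    and vn: "v n = col_mult mu"
    using row_is_horizontal_strip[OF Suc.prems(1), of \<alpha> \<beta> "x n" "h n" "v n"]
      Suc.prems(3)[of n] top by auto
  \<comment> \<open>Deleting the top row must put \<open>undefined\<close> at the freed indices,
    since labelings with \<open>n\<close> rows are extensional.\<close>
  define h' v' where "h' = h(n := undefined)" and "v' = v(Suc n := undefined)"
  have "(h', v') \<in> labelings n (\<lambda>_. 0) (col_mult mu) 0"
    using Suc.prems(2) vn
    by (auto simp: h'_def v'_def labelings_def PiE_def extensional_def)
  moreover have "vertex_weight \<alpha> \<beta> (x k) (h' k j) (v' k j) (h' k (Suc j)) (v' (Suc k) j) \<noteq> 0"
    if "k < n" for k j
    using Suc.prems(3)[of k j] that by (simp add: h'_def v'_def)
  ultimately have "(h', v') \<in> strip_labelings n mu"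
    using Suc.IH mu by (simp add: horizontal_strip_def)
  moreover have "(h, v) = add_strip n lam (mu, h', v')"
    using hn top by (auto simp: add_strip_def h'_def v'_def)
  ultimately show ?case
    using mu by auto
qed simp

section \<open>Weights of strip labelings and the branching recursion\<close>

lemma has_weight_add_strip:
  assumes mu: "horizontal_strip lam mu" and L: "(h, v) \<in> strip_labelings n mu"
    and p: "has_weight (\<lambda>k. vertex_weight \<alpha> \<beta> (x k)) n (h, v) p"
  shows "has_weight (\<lambda>k. vertex_weight \<alpha> \<beta> (x k)) (Suc n) (add_strip n lam (mu, h, v))
    (p * (x n / (1 - \<alpha> * x n)) ^ (psize lam - psize mu)
       * ((1 + \<beta> * x n) / (1 - \<alpha> * x n)) ^ skew_rows mu (pbar lam))"
proof -
  let ?w = "\<lambda>k. vertex_weight \<alpha> \<beta> (x k)"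
  define h' v' where "h' = h(n := \<lambda>j. lam j - mu j)" and "v' = v(Suc n := col_mult lam)"
  have "(h, v) \<in> labelings n (\<lambda>_. 0) (col_mult mu) 0"
    using strip_labelings_subset mu L by (auto simp: horizontal_strip_def)
  then have "v' n = col_mult mu"
    by (simp add: labelings_def v'_def)
  moreover have "partial_weight ?w n (h', v') N = partial_weight ?w n (h, v) N" for N
    by (rule partial_weight_cong) (auto simp: h'_def v'_def)
  ultimately have split: "partial_weight ?w (Suc n) (h', v') N = partial_weight ?w n (h, v) N *
      (\<Prod>j<N. ?w n (lam j - mu j) (col_mult mu j) (lam (Suc j) - mu (Suc j)) (col_mult lam j))"
    for N
    by (simp add: partial_weight_Suc) (simp add: h'_def v'_def)
  have "has_weight ?w (Suc n) (h', v')
    (p * ((x n / (1 - \<alpha> * x n)) ^ (psize lam - psize mu)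
       * ((1 + \<beta> * x n) / (1 - \<alpha> * x n)) ^ skew_rows mu (pbar lam)))"
    unfolding has_weight_def split
    \<comment> \<open>The lower rows and the new row stabilise separately; beyond both thresholds
      the product of their partial weights is constant.\<close>
    using p[unfolded has_weight_def] horizontal_strip_row_weight[OF mu, of \<alpha> \<beta> "x n"]
    by eventually_elim (simp only:)
  then show ?thesis
    by (simp add: add_strip_def h'_def v'_def mult.assoc)
qed

lemma strip_labelings_has_weight:
  assumes "is_partition lam" "L \<in> strip_labelings n lam"
  shows "\<exists>p. has_weight (\<lambda>k. vertex_weight \<alpha> \<beta> (x k)) n L p"
  using assms
proof (induction n arbitrary: lam L)
  case 0
  then show ?case
    by (auto simp: has_weight_def partial_weight_def split: prod.splits)
next
  case (Suc n)
  then obtain mu h v where "horizontal_strip lam mu" "(h, v) \<in> strip_labelings n mu"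
    "L = add_strip n lam (mu, h, v)"
    by auto
  moreover from this obtain p where "has_weight (\<lambda>k. vertex_weight \<alpha> \<beta> (x k)) n (h, v) p"
    using Suc.IH[of mu "(h, v)"] unfolding horizontal_strip_def by blast
  ultimately show ?case
    using has_weight_add_strip by blast
qed

text \<open>Injectivity of \<open>add_strip\<close> turns the sum into a double sum over
  \<open>mu\<close> and the labelings below. The factor of the top row depends on \<open>mu\<close>
  only, so the inner sums are covered by the induction hypothesis.\<close>

lemma sum_weight_strip_labelings:
  assumes "is_partition lam"
  shows "(\<Sum>L\<in>strip_labelings n lam. weight (\<lambda>k. vertex_weight \<alpha> \<beta> (x k)) n L) =
    grothendieck \<alpha> \<beta> x n lam"
  using assms
proof (induction n arbitrary: lam)
  case 0
  have "weight (\<lambda>k. vertex_weight \<alpha> \<beta> (x k)) 0 L = 1" for L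
    by (intro weight_eqI) (simp add: has_weight_def partial_weight_def split: prod.splits)
  with 0 show ?case
    by (simp add: labelings_0)
next
  case (Suc n)
  let ?w = "\<lambda>k. vertex_weight \<alpha> \<beta> (x k)"
  let ?S = "{mu. horizontal_strip lam mu}"
  define c where "c mu = (x n / (1 - \<alpha> * x n)) ^ (psize lam - psize mu)
       * ((1 + \<beta> * x n) / (1 - \<alpha> * x n)) ^ skew_rows mu (pbar lam)" for mu
  have part: "is_partition mu" if "horizontal_strip lam mu" for mu
    using that by (simp add: horizontal_strip_def)
  have step: "weight ?w (Suc n) (add_strip n lam (mu, L)) = weight ?w n L * c mu"
    if mu: "horizontal_strip lam mu" and L: "L \<in> strip_labelings n mu" for mu L
  proof -
    obtain h v where hv: "L = (h, v)"
      by (cases L)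
    obtain p where p: "has_weight ?w n L p"
      using strip_labelings_has_weight[OF part[OF mu] L] by blast
    show ?thesis
      using has_weight_add_strip[OF mu L[unfolded hv] p[unfolded hv], THEN weight_eqI]
        weight_eqI[OF p]
      by (simp add: hv c_def mult.assoc)
  qed
  have "(\<Sum>L\<in>strip_labelings (Suc n) lam. weight ?w (Suc n) L) =
      (\<Sum>(mu, L)\<in>Sigma ?S (strip_labelings n). weight ?w n L * c mu)"
    by (auto simp: sum.reindex[OF inj_on_add_strip] step intro!: sum.cong)
  also have "\<dots> = (\<Sum>mu\<in>?S. \<Sum>L\<in>strip_labelings n mu. weight ?w n L * c mu)"
    by (rule sum.Sigma[symmetric])
      (auto intro: finite_horizontal_strips finite_strip_labelings part)
  also have "\<dots> = (\<Sum>mu\<in>?S. grothendieck \<alpha> \<beta> x n mu * c mu)"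
    by (simp add: sum_distrib_right[symmetric] Suc.IH part)
  finally show ?case
    by (simp add: c_def mult.assoc)
qed

theorem theorem3p1:
  fixes \<alpha> \<beta> :: "'a::field" and x :: "nat \<Rightarrow> 'a" and n :: nat and lam :: "nat \<Rightarrow> nat"
  assumes "n \<ge> 1"
    and "\<And>k. k < n \<Longrightarrow> 1 - \<alpha> * x k \<noteq> 0"
    and "is_partition lam"
  shows "partition_function_exists (\<lambda>k. vertex_weight \<alpha> \<beta> (x k)) n (\<lambda>_. 0) (col_mult lam) 0 \<and>
    grothendieck \<alpha> \<beta> x n lam =
      partition_function (\<lambda>k. vertex_weight \<alpha> \<beta> (x k)) n (\<lambda>_. 0) (col_mult lam) 0"
proof -
  let ?w = "\<lambda>k. vertex_weight \<alpha> \<beta> (x k)"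
  let ?A = "labelings n (\<lambda>_. 0) (col_mult lam) 0"
  let ?B = "nonzero_labelings ?w n (\<lambda>_. 0) (col_mult lam) 0"
  note lam = assms(3)
  \<comment> \<open>A labeling that does not come from a chain of strips contains a vanishing
    vertex.\<close>
  have zero: "has_weight ?w n L 0" if L: "L \<in> ?A" "L \<notin> strip_labelings n lam" for L
  proof -
    obtain h v where hv: "L = (h, v)"
      by (cases L)
    with L nonvanishing_labeling_in_strip_labelings[OF lam, of h v n \<alpha> \<beta> x]
    obtain k j where "k < n" "?w k (h k j) (v k j) (h k (Suc j)) (v (Suc k) j) = 0"
      by blast
    then show ?thesis
      unfolding hv by (rule has_weight_0_if_vertex_0)
  qed
  have sub: "?B \<subseteq> strip_labelings n lam"
    using zero[THEN weight_eqI] by (auto simp: nonzero_labelings_def)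
  have "\<exists>p. has_weight ?w n L p" if "L \<in> ?A" for L
    using zero strip_labelings_has_weight[OF lam] that by blast
  moreover have "finite ?B"
    using sub finite_strip_labelings[OF lam] by (rule finite_subset)
  \<comment> \<open>Strip labelings may have weight \<open>0\<close>, for instance if some
    \<open>x k\<close> is \<open>0\<close>, so the sum is extended by zero terms.\<close>
  moreover have "partition_function ?w n (\<lambda>_. 0) (col_mult lam) 0 =
      (\<Sum>L\<in>strip_labelings n lam. weight ?w n L)"
    unfolding partition_function_def
    using strip_labelings_subset[OF lam]
    by (intro sum.mono_neutral_left finite_strip_labelings lam sub)
      (auto simp: nonzero_labelings_def)
  ultimately show ?thesis
    by (simp add: partition_function_exists_def sum_weight_strip_labelings[OF lam])
qed

end
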